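(* Let $n\ge1$ be an integer. The solution $u_{2n}(x,t)$ to $$\frac{\partial u}{\partial t}=(-1)^{n+1}\frac{\partial^{2n}u}{\partial x^{2n}},\quad x\in\mathbb{R},\ t>0,$$ with initial condition $u(x,0)=\delta(x)$ can be written as $$u_{2n}(x,t)=\frac{1}{\pi x}\,E\left[\sin\left(x\,G^{2n}(1/t)\right)\right],\qquad x\in\mathbb{R},\ t>0,$$ where $G^{\gamma}(t)$ denotes, for $\gamma>0$ and $t>0$, a positive random variable with the generalized gamma density $$g^{\gamma}(x,t)=\gamma\,\frac{x^{\gamma-1}}{t}\exp\left(-\frac{x^{\gamma}}{t}\right),\quad x>0.$$
   Context: $\delta$ is the Dirac delta at $0$ and $E$ is expectation. In $G^{2n}(1/t)$ the superscript $2n$ is the parameter $\gamma$ of the distribution, not a power. "The solution" means the fundamental solution, i.e. the function with Fourier transform $\int_{\mathbb{R}}e^{i\beta x}u_{2n}(x,t)\,dx=e^{-t\beta^{2n}}$; equivalently $u_{2n}(x,t)=\frac{1}{\pi}\int_0^\infty e^{-t\beta^{2n}}\cos(\beta x)\,d\beta$. At $x=0$ the right-hand side of the representation is understood as its limit as $x\to0$. *)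

theory Defs
  imports "HOL-Probability.Probability"
begin

text \<open>Throughout, \<open>u x t\<close> is a function of position \<open>x\<close> and time \<open>t\<close>; its values at
  \<open>t \<le> 0\<close> are irrelevant.\<close>

definition classical_solution :: "nat \<Rightarrow> (real \<Rightarrow> real \<Rightarrow> real) \<Rightarrow> bool" where
  "classical_solution n u \<longleftrightarrow>
     (\<forall>t>0. \<forall>x.
        (\<forall>k<2 * n. (deriv ^^ k) (\<lambda>y. u y t) differentiable (at x)) \<and>
        ((\<lambda>s. u x s) has_real_derivative
            (-1) ^ (n + 1) * (deriv ^^ (2 * n)) (\<lambda>y. u y t) x) (at t))"

text \<open>The initial condition \<open>u(x,0) = \<delta>(x)\<close>: as \<open>t\<close> decreases to \<open>0\<close>, the signed measures
  \<open>u(x,t) dx\<close> converge weakly to the Dirac measure at \<open>0\<close>.\<close>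

definition initial_delta :: "(real \<Rightarrow> real \<Rightarrow> real) \<Rightarrow> bool" where
  "initial_delta u \<longleftrightarrow>
     (\<forall>\<phi>::real \<Rightarrow> real. continuous_on UNIV \<phi> \<longrightarrow> bounded (range \<phi>) \<longrightarrow>
        ((\<lambda>t. \<integral>x. \<phi> x * u x t \<partial>lborel) \<longlongrightarrow> \<phi> 0) (at_right 0))"

text \<open>Among the solutions of the Cauchy problem, the fundamental solution is the one whose Fourier transform in \<open>x\<close> is \<open>exp (- t \<beta>\<^sup>2\<^sup>n)\<close>. Integrability is required
  explicitly because the Bochner integral of a non-integrable function is \<open>0\<close>.\<close>

definition fundamental_solution :: "nat \<Rightarrow> (real \<Rightarrow> real \<Rightarrow> real) \<Rightarrow> bool" where
  "fundamental_solution n u \<longleftrightarrow>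
     classical_solution n u \<and> initial_delta u \<and>
     (\<forall>t>0. integrable lborel (\<lambda>x. u x t) \<and>
        (\<forall>\<beta>::real. (\<integral>x. exp (\<i> * of_real (\<beta> * x)) * of_real (u x t) \<partial>lborel) =
           complex_of_real (exp (- t * \<beta> ^ (2 * n)))))"

definition gen_gamma_density :: "real \<Rightarrow> real \<Rightarrow> real \<Rightarrow> real" where
  "gen_gamma_density \<gamma> x t =
     (if x > 0 then \<gamma> * (x powr (\<gamma> - 1) / t) * exp (- (x powr \<gamma> / t)) else 0)"

lemma prob_space_gen_gamma:
  assumes "\<gamma> > 0" "t > 0"
  shows "prob_space (density lborel (\<lambda>x. ennreal (gen_gamma_density \<gamma> x t)))"
proof -
  let ?f = "\<lambda>x. \<gamma> * (x powr (\<gamma> - 1) / t) * exp (- (x powr \<gamma> / t))"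
  let ?F = "\<lambda>x. - exp (- (x powr \<gamma> / t))"
  have D: "DERIV ?F x :> ?f x" if "x > 0" for x
    using that assms by (auto intro!: derivative_eq_intros simp: powr_diff field_simps)
  have c: "isCont ?f x" if "x > 0" for x
    using that assms by (auto intro!: continuous_intros)
  have l0: "((?F \<circ> real_of_ereal) \<longlongrightarrow> -1) (at_right (ereal 0))"
  proof -
    have "((\<lambda>x. - exp (- (x powr \<gamma> / t))) \<longlongrightarrow> - exp (- (0 / t))) (at_right 0)"
      using assms by (intro tendsto_intros tendsto_powr' tendsto_eq_intros)
        (auto intro!: tendsto_eq_intros tendsto_zero_powrI simp: eventually_at_filter)
    then show ?thesis
      by (simp add: ereal_tendsto_simps1)
  qed
  have l1: "((?F \<circ> real_of_ereal) \<longlongrightarrow> 0) (at_left \<infinity>)"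
  proof -
    have "LIM x at_top. x powr \<gamma> / t :> at_top"
      using assms by real_asymp
    then have "((\<lambda>x. - exp (- (x powr \<gamma> / t))) \<longlongrightarrow> - 0) at_top"
      by (intro tendsto_minus filterlim_compose[OF exp_at_bot]
          filterlim_compose[OF filterlim_uminus_at_bot_at_top])
    then show ?thesis
      by (simp add: ereal_tendsto_simps1)
  qed
  note FTC = interval_integral_FTC_nonneg[of 0 \<infinity> ?F ?f "-1" 0]
  have 1: "set_integrable lborel (einterval 0 \<infinity>) ?f"
    using assms l0 l1 by (intro FTC(1) D c) (auto simp: zero_ereal_def)
  have 2: "(LBINT x=0..\<infinity>. ?f x) = 0 - (-1)"
    using assms l0 l1 by (intro FTC(2) D c) (auto simp: zero_ereal_def)
  have eq: "indicator (einterval 0 \<infinity>) x *\<^sub>R ?f x = gen_gamma_density \<gamma> x t" for x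
    by (auto simp: gen_gamma_density_def einterval_def indicator_def)
  have 3: "integrable lborel (\<lambda>x. gen_gamma_density \<gamma> x t)"
    using 1 unfolding set_integrable_def eq .
  have 4: "(\<integral>x. gen_gamma_density \<gamma> x t \<partial>lborel) = 1"
    using 2 unfolding interval_lebesgue_integral_def set_lebesgue_integral_def eq by simp
  have "(\<integral>\<^sup>+x. ennreal (gen_gamma_density \<gamma> x t) \<partial>lborel) = 1"
  proof (subst nn_integral_eq_integral[OF 3])
    show "AE x in lborel. 0 \<le> gen_gamma_density \<gamma> x t"
      using assms by (auto simp: gen_gamma_density_def)
  qed (simp add: 4)
  then show ?thesis
    using 3 by (intro prob_spaceI) (simp add: emeasure_density)
qed

end

theory Submission
  imports Defs
begin

text \<open>Fourier inversion, obtained by mollifying with a Gaussian, shows that a fundamental solution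
  can only be \<open>(1 / 2\<pi>) \<integral> cos (\<beta>x) exp (-t \<beta>\<^sup>2\<^sup>n) d\<beta>\<close>. Two integrations by parts show that
  this function decays like \<open>1 / x\<^sup>2\<close>, so it is integrable; inversion then gives its Fourier
  transform, and the scaling \<open>x \<mapsto> x / t\<^sup>1\<^sup>/\<^sup>2\<^sup>n\<close> its initial value. A further integration by
  parts turns the cosine integral into the expectation of the sine, since
  \<open>exp (-t \<beta>\<^sup>2\<^sup>n)\<close> is the tail of the generalized gamma distribution.\<close>

text \<open>The formula is claimed for every fundamental solution, so the transform must determine
  \<open>u\<close> at each point and not just almost everywhere; continuity, which comes from the
  classical differentiability in x, makes this possible. For n \<ge> 2 the second derivative of exp
  (-t \<beta>^(2n)) at 0 vanishes, so \<open>u\<close> cannot be a probability density: it takes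
  negative values, and results on characteristic functions or on weak convergence of probability
  measures do not apply to it. Inversion is therefore proved at continuity points of arbitrary
  integrable complex functions with integrable transform. It serves twice: applied to
  \<open>u\<close> it gives uniqueness, applied to exp (-t \<beta>^(2n)) it gives the transform of
  the kernel. The cosine integral runs over the whole line while the gamma variable is positive;
  evenness links the two and turns 1 / (2 pi) into 1 / pi.\<close>

section \<open>Integration by parts on the line and differentiation under the integral\<close>

text \<open>The form in which integration by parts is used: \<open>F\<close> collects all boundary
  terms, so that even a double integration by parts costs one application.\<close>

lemma integral_derivative_UNIV_eq_0:
  fixes F f :: "real \<Rightarrow> real"
  assumes deriv: "\<And>x. (F has_real_derivative f x) (at x)"
    and cont: "\<And>x. isCont f x"
    and int: "integrable lborel f"
    and top: "(F \<longlongrightarrow> 0) at_top" and bot: "(F \<longlongrightarrow> 0) at_bot"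
  shows "(\<integral>x. f x \<partial>lborel) = 0"
proof -
  have "(LBINT x=-\<infinity>..\<infinity>. f x) = 0 - 0"
  proof (rule interval_integral_FTC_integrable)
    show "(F has_vector_derivative f x) (at x)" for x
      using deriv by (simp add: has_real_derivative_iff_has_vector_derivative)
    show "set_integrable lborel (einterval (- \<infinity>) \<infinity>) f"
      using int by (simp add: set_integrable_def)
  qed (use cont top bot in \<open>auto simp: ereal_tendsto_simps1\<close>)
  then show ?thesis
    by (simp add: interval_lebesgue_integral_def set_lebesgue_integral_def)
qed

text \<open>The mean value inequality on the convex set \<open>S\<close> bounds the difference
  quotients by \<open>w\<close>, and dominated convergence along sequences does the rest.
  Restricting to \<open>S\<close> matters for the time derivative, where a majorant exists only away
  from time 0.\<close>

lemma has_real_derivative_integral: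
  fixes f f' :: "real \<Rightarrow> 'a \<Rightarrow> real"
  assumes "s \<in> S" "open S" "convex S"
    and int: "\<And>r. r \<in> S \<Longrightarrow> integrable M (f r)"
    and deriv: "\<And>r x. r \<in> S \<Longrightarrow> ((\<lambda>r. f r x) has_real_derivative f' r x) (at r)"
    and meas: "f' s \<in> borel_measurable M"
    and w: "integrable M w"
    and bound: "\<And>r x. r \<in> S \<Longrightarrow> \<bar>f' r x\<bar> \<le> w x"
  shows "((\<lambda>r. \<integral>x. f r x \<partial>M) has_real_derivative (\<integral>x. f' s x \<partial>M)) (at s)"
  unfolding has_field_derivative_iff tendsto_at_iff_sequentially comp_def
proof (intro allI impI)
  fix X assume ne: "\<forall>i. X i \<in> UNIV - {s}" and X: "X \<longlonglongrightarrow> s"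
  from topological_tendstoD[OF X \<open>open S\<close> \<open>s \<in> S\<close>] obtain N where "\<And>i. i \<ge> N \<Longrightarrow> X i \<in> S"
    by (auto simp: eventually_sequentially)
  then have N: "X (i + N) \<in> S" for i
    by simp
  define Y where "Y i = X (i + N)" for i
  have Y: "Y i \<in> S" "Y i \<noteq> s" for i
    using N ne by (auto simp: Y_def)
  have YL: "Y \<longlonglongrightarrow> s"
    unfolding Y_def using X by (rule LIMSEQ_ignore_initial_segment)
  have lip: "\<bar>f (Y i) x - f s x\<bar> \<le> w x * \<bar>Y i - s\<bar>" for i x
  proof -
    have "norm (f (Y i) x - f s x) \<le> w x * norm (Y i - s)"
    proof (rule field_differentiable_bound[OF \<open>convex S\<close>])
      show "((\<lambda>r. f r x) has_field_derivative f' z x) (at z within S)" if "z \<in> S" for z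
        using deriv[OF that] by (rule has_field_derivative_at_within)
    qed (use bound Y \<open>s \<in> S\<close> in auto)
    then show ?thesis by simp
  qed
  have "(\<lambda>i. \<integral>x. (f (Y i) x - f s x) / (Y i - s) \<partial>M) \<longlonglongrightarrow> (\<integral>x. f' s x \<partial>M)"
  proof (rule integral_dominated_convergence[where w = w])
    show "(\<lambda>x. (f (Y i) x - f s x) / (Y i - s)) \<in> borel_measurable M" for i
      using int[OF Y(1)] int[OF \<open>s \<in> S\<close>] by measurable
    show "AE x in M. norm ((f (Y i) x - f s x) / (Y i - s)) \<le> w x" for i
      using lip Y by (auto simp: divide_le_eq)
    show "AE x in M. (\<lambda>i. (f (Y i) x - f s x) / (Y i - s)) \<longlonglongrightarrow> f' s x"
      using deriv[OF \<open>s \<in> S\<close>] Y YL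
      unfolding has_field_derivative_iff tendsto_at_iff_sequentially comp_def by auto
  qed (fact meas w)+
  moreover have "(\<integral>x. (f (Y i) x - f s x) / (Y i - s) \<partial>M)
      = ((\<integral>x. f (Y i) x \<partial>M) - (\<integral>x. f s x \<partial>M)) / (Y i - s)" for i
    unfolding integral_divide_zero using int[OF Y(1)] int[OF \<open>s \<in> S\<close>] by simp
  ultimately have "(\<lambda>i. ((\<integral>x. f (Y i) x \<partial>M) - (\<integral>x. f s x \<partial>M)) / (Y i - s)) \<longlonglongrightarrow> (\<integral>x. f' s x \<partial>M)"
    by (simp only:)
  then show "(\<lambda>i. ((\<integral>x. f (X i) x \<partial>M) - (\<integral>x. f s x \<partial>M)) / (X i - s)) \<longlonglongrightarrow> (\<integral>x. f' s x \<partial>M)"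
    unfolding Y_def by (rule LIMSEQ_offset)
qed

section \<open>Fourier inversion by Gaussian mollification\<close>

text \<open>Serves as a tail bound: at w = k z it makes k times the density at k z at most 2 / (k
  z^2), which tends to 0 uniformly away from z = 0.\<close>

lemma std_normal_density_mult_power2_le: "w\<^sup>2 * std_normal_density w \<le> 2"
proof -
  have "w\<^sup>2 / 2 \<le> exp (w\<^sup>2 / 2)"
    using exp_ge_add_one_self[of "w\<^sup>2 / 2"] by linarith
  then have "w\<^sup>2 * exp (- w\<^sup>2 / 2) \<le> 2"
    by (simp add: exp_minus field_simps)
  moreover have "1 \<le> sqrt (2 * pi)"
    using pi_ge_two by (intro real_le_rsqrt) simp
  ultimately have "w\<^sup>2 * exp (- w\<^sup>2 / 2) \<le> 2 * sqrt (2 * pi)"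
    by linarith
  then show ?thesis
    by (simp add: std_normal_density_def divide_le_eq)
qed

text \<open>As \<open>f\<close> is integrable but possibly unbounded, no single form of the integral
  has an evident majorant. Near \<open>x\<close> the variable is rescaled, so the Gaussian is fixed
  and continuity bounds \<open>f\<close>; far from \<open>x\<close> it is not rescaled, so
  \<open>f\<close> is fixed and the Gaussian weight is bounded.\<close>

lemma gaussian_approximate_identity:
  fixes f :: "real \<Rightarrow> complex"
  assumes f: "integrable lborel f" and cont: "isCont f x"
  shows "(\<lambda>m. \<integral>y. f y * of_real (real (Suc m) * std_normal_density (real (Suc m) * (y - x))) \<partial>lborel)
           \<longlonglongrightarrow> f x"
proof -
  define h where "h z = f (x + z)" for z
  define \<phi> where "\<phi> = std_normal_density"
  have [measurable]: "f \<in> borel_measurable borel"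
    using borel_measurable_integrable[OF f] by simp
  have [measurable]: "\<phi> \<in> borel_measurable borel"
    by (simp add: \<phi>_def)
  have h_int: "integrable lborel h"
    unfolding h_def using lborel_integrable_real_affine[OF f, of 1 x] by simp
  have [measurable]: "h \<in> borel_measurable borel"
    using borel_measurable_integrable[OF h_int] by simp
  have h_cont: "isCont h 0"
    unfolding h_def by (rule isCont_o2[where f = "\<lambda>z. x + z"]) (use cont in auto)
  \<comment> \<open>The tolerance 1 only serves to bound \<open>h\<close> near 0; the limit itself
    comes from pointwise continuity inside dominated convergence.\<close>
  then obtain d where d: "d > 0" "\<And>z. \<bar>z\<bar> < d \<Longrightarrow> norm (h z - h 0) < 1"
    unfolding isCont_def LIM_eq using zero_less_one by (metis diff_zero real_norm_def norm_zero diff_self)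
  define A :: "real \<Rightarrow> real" where "A z = indicator {z. \<bar>z\<bar> < d} z" for z
  have [measurable]: "A \<in> borel_measurable borel"
    unfolding A_def by measurable
  define k where "k m = real (Suc m)" for m
  have k: "k m \<ge> 1" "k m > 0" for m by (auto simp: k_def)
  have inf: "filterlim k at_top sequentially"
    unfolding k_def using filterlim_real_sequentially filterlim_Suc by (rule filterlim_compose)
  have near: "(\<lambda>m. \<integral>z. of_real (\<phi> z * A (z / k m)) * h (z / k m) \<partial>lborel) \<longlonglongrightarrow> (\<integral>z. of_real (\<phi> z) * h 0 \<partial>lborel)"
  proof (rule integral_dominated_convergence[where w = "\<lambda>z. \<phi> z * (1 + norm (h 0))"])
    show "AE z in lborel. (\<lambda>m. of_real (\<phi> z * A (z / k m)) * h (z / k m)) \<longlonglongrightarrow> of_real (\<phi> z) * h 0"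
    proof (intro AE_I2)
      fix z :: real
      have z0: "(\<lambda>m. z / k m) \<longlonglongrightarrow> 0"
        by (intro real_tendsto_divide_at_top[OF tendsto_const] inf)
      have "eventually (\<lambda>m. \<bar>z / k m\<bar> < d) sequentially"
        using tendsto_norm[OF z0] d(1) by (auto dest!: order_tendstoD(2))
      then have "eventually (\<lambda>m. 1 = A (z / k m)) sequentially"
        by eventually_elim (auto simp: A_def)
      then have "(\<lambda>m. A (z / k m)) \<longlonglongrightarrow> 1"
        by (rule Lim_transform_eventually[OF tendsto_const])
      moreover have "(\<lambda>m. h (z / k m)) \<longlonglongrightarrow> h 0"
        using h_cont z0 by (rule isCont_tendsto_compose)
      ultimately have "(\<lambda>m. of_real (\<phi> z * A (z / k m)) * h (z / k m)) \<longlonglongrightarrow> of_real (\<phi> z * 1) * h 0"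
        by (intro tendsto_intros)
      then show "(\<lambda>m. of_real (\<phi> z * A (z / k m)) * h (z / k m)) \<longlonglongrightarrow> of_real (\<phi> z) * h 0"
        by simp
    qed
    show "AE z in lborel. norm (of_real (\<phi> z * A (z / k m)) * h (z / k m)) \<le> \<phi> z * (1 + norm (h 0))" for m
    proof (intro AE_I2)
      fix z :: real
      have "norm (h (z / k m)) \<le> 1 + norm (h 0)" if "\<bar>z / k m\<bar> < d"
        using d(2)[OF that] norm_triangle_ineq2[of "h (z / k m)" "h 0"] by linarith
      then show "norm (of_real (\<phi> z * A (z / k m)) * h (z / k m)) \<le> \<phi> z * (1 + norm (h 0))"
        by (auto simp: A_def indicator_def norm_mult \<phi>_def normal_density_nonneg intro!: mult_left_mono)
    qed
  qed (auto simp: \<phi>_def)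
  \<comment> \<open>Where \<open>A\<close> vanishes, z^2 \<ge> d^2, and the weight is at most
    \<open>2 / d\<^sup>2 / k m\<close>: it tends to 0, and since k m \<ge> 1 it is dominated
    independently of \<open>m\<close>.\<close>
  have far: "(\<lambda>m. \<integral>z. of_real (k m * \<phi> (k m * z) * (1 - A z)) * h z \<partial>lborel) \<longlonglongrightarrow> integral\<^sup>L lborel (\<lambda>z::real. 0)"
  proof (rule integral_dominated_convergence[where w = "\<lambda>z. 2 / d\<^sup>2 * norm (h z)"])
    have le: "k m * \<phi> (k m * z) * (1 - A z) \<le> 2 / d\<^sup>2 / k m" for m z
    proof (cases "\<bar>z\<bar> < d")
      case True
      then show ?thesis using k[of m] by (simp add: A_def)
    next
      case False
      then have z: "z\<^sup>2 \<ge> d\<^sup>2" "z \<noteq> 0"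
        using d(1) by (auto simp: abs_le_square_iff[symmetric])
      have "(k m * z)\<^sup>2 * \<phi> (k m * z) \<le> 2"
        unfolding \<phi>_def by (rule std_normal_density_mult_power2_le)
      then have "k m * \<phi> (k m * z) * (z\<^sup>2 * k m) \<le> 2"
        by (simp add: power_mult_distrib power2_eq_square ac_simps)
      moreover have "z\<^sup>2 * k m > 0"
        using k(2)[of m] z by simp
      ultimately have "k m * \<phi> (k m * z) \<le> 2 / z\<^sup>2 / k m"
        by (simp add: pos_le_divide_eq)
      also have "\<dots> \<le> 2 / d\<^sup>2 / k m"
        using k[of m] z d(1) by (intro divide_right_mono divide_left_mono) auto
      finally show ?thesis using False by (simp add: A_def)
    qed
    have nonneg: "0 \<le> k m * \<phi> (k m * z) * (1 - A z)" for m z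
      using k[of m] by (auto simp: A_def indicator_def \<phi>_def)
    show "AE z in lborel. norm (of_real (k m * \<phi> (k m * z) * (1 - A z)) * h z) \<le> 2 / d\<^sup>2 * norm (h z)" for m
    proof (intro AE_I2)
      fix z
      have "2 / d\<^sup>2 / k m \<le> 2 / d\<^sup>2 / 1"
        using k[of m] by (intro divide_left_mono) auto
      with le[of m z] have "k m * \<phi> (k m * z) * (1 - A z) \<le> 2 / d\<^sup>2" by simp
      then show "norm (of_real (k m * \<phi> (k m * z) * (1 - A z)) * h z) \<le> 2 / d\<^sup>2 * norm (h z)"
        unfolding norm_mult norm_of_real using nonneg[of m z] by (intro mult_right_mono) auto
    qed
    have lim: "(\<lambda>m. k m * \<phi> (k m * z) * (1 - A z)) \<longlonglongrightarrow> 0" for z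
    proof (rule tendsto_sandwich[OF _ _ tendsto_const])
      show "(\<lambda>m. 2 / d\<^sup>2 / k m) \<longlonglongrightarrow> 0"
        by (intro real_tendsto_divide_at_top[OF tendsto_const] inf)
    qed (use le nonneg in auto)
    show "AE z in lborel. (\<lambda>m. of_real (k m * \<phi> (k m * z) * (1 - A z)) * h z) \<longlonglongrightarrow> 0"
      using tendsto_mult_left_zero[OF tendsto_of_real[OF lim, simplified]] by auto
  qed (use h_int in auto)
  have eq: "(\<integral>y. f y * of_real (k m * \<phi> (k m * (y - x))) \<partial>lborel) =
      (\<integral>z. of_real (\<phi> z * A (z / k m)) * h (z / k m) \<partial>lborel) +
      (\<integral>z. of_real (k m * \<phi> (k m * z) * (1 - A z)) * h z \<partial>lborel)" for m
  proof -
    \<comment> \<open>A crude bound for fixed \<open>m\<close>, needed only to split the integral: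
      with \<open>c\<close> a value of \<open>A\<close> or of 1 - \<open>A\<close>, both pieces are
      dominated by a multiple of the norm of \<open>h\<close>.\<close>
    have b: "k m * \<phi> (k m * z) * \<bar>c\<bar> \<le> k m" if "\<bar>c\<bar> \<le> 1" for z c
    proof -
      have "1 \<le> sqrt (2 * pi)"
        using pi_ge_two by (intro real_le_rsqrt) simp
      moreover have "exp (- (k m * z)\<^sup>2 / 2) \<le> 1" by simp
      ultimately have "exp (- (k m * z)\<^sup>2 / 2) \<le> sqrt (2 * pi)" by linarith
      then have "\<phi> (k m * z) \<le> 1"
        by (simp add: \<phi>_def std_normal_density_def)
      then have "\<phi> (k m * z) * \<bar>c\<bar> \<le> 1 * 1"
        using that by (intro mult_mono) (auto simp: \<phi>_def)
      then show ?thesis using k[of m] by (simp add: mult.assoc)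
    qed
    have I: "integrable lborel (\<lambda>z. of_real (k m * \<phi> (k m * z) * B z) * h z)"
      if [measurable]: "B \<in> borel_measurable borel" and B: "\<And>z. \<bar>B z\<bar> \<le> 1" for B :: "real \<Rightarrow> real"
    proof (rule Bochner_Integration.integrable_bound[where f = "\<lambda>z. k m * norm (h z)"])
      show "AE z in lborel. norm (of_real (k m * \<phi> (k m * z) * B z) * h z) \<le> norm (k m * norm (h z))"
      proof (intro AE_I2)
        fix z
        show "norm (of_real (k m * \<phi> (k m * z) * B z) * h z) \<le> norm (k m * norm (h z))"
          using mult_right_mono[OF b[OF B[of z], of z], of "norm (h z)"] k(2)[of m]
          by (simp add: norm_mult abs_mult \<phi>_def)
      qed
    qed (use h_int in auto)
    have "(\<integral>y. f y * of_real (k m * \<phi> (k m * (y - x))) \<partial>lborel) =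
        (\<integral>z. of_real (k m * \<phi> (k m * z) * A z) * h z + of_real (k m * \<phi> (k m * z) * (1 - A z)) * h z \<partial>lborel)"
      by (subst lborel_integral_real_affine[of 1 _ x]) (simp_all add: h_def algebra_simps)
    also have "\<dots> = (\<integral>z. of_real (k m * \<phi> (k m * z) * A z) * h z \<partial>lborel) +
        (\<integral>z. of_real (k m * \<phi> (k m * z) * (1 - A z)) * h z \<partial>lborel)"
      by (intro Bochner_Integration.integral_add I) (auto simp: A_def indicator_def)
    \<comment> \<open>Only the near piece is rescaled; the Jacobian 1 / k cancels the factor k of
      the mollifier.\<close>
    also have "(\<integral>z. of_real (k m * \<phi> (k m * z) * A z) * h z \<partial>lborel) =
        \<bar>1 / k m\<bar> *\<^sub>R (\<integral>z. of_real (k m * \<phi> z * A (z / k m)) * h (z / k m) \<partial>lborel)"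
      using k(2)[of m] by (subst lborel_integral_real_affine[of "1 / k m" _ 0]) auto
    also have "\<dots> = (\<integral>z. (1 / k m) *\<^sub>R (of_real (k m * \<phi> z * A (z / k m)) * h (z / k m)) \<partial>lborel)"
      using k(2)[of m] by simp
    also have "\<dots> = (\<integral>z. of_real (\<phi> z * A (z / k m)) * h (z / k m) \<partial>lborel)"
      using k(2)[of m] by (simp add: scaleR_conv_of_real field_simps)
    finally show ?thesis .
  qed
  have "(\<integral>z. complex_of_real (\<phi> z) * h 0 \<partial>lborel) = h 0"
    by (simp add: \<phi>_def)
  then show ?thesis
    using tendsto_add[OF near far] unfolding eq[symmetric] by (simp add: h_def \<phi>_def k_def)
qed

lemma norm_iexp [simp]: "norm (iexp x) = 1"
  by (simp add: norm_exp_i_times)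

text \<open>Explains the choice of convergence factor below: the transform of the wide Gaussian in
  \<beta> / k is the narrow mollifier of the approximate identity. The factor sqrt (2 pi) turns the
  density into the characteristic function of the standard normal law.\<close>

lemma fourier_std_normal_density:
  assumes "k > 0"
  shows "(\<integral>\<beta>. iexp (\<beta> * z) * of_real (std_normal_density (\<beta> / k)) \<partial>lborel)
           = of_real (sqrt (2 * pi) * (k * std_normal_density (k * z)))"
proof -
  have "(\<integral>\<beta>. iexp (\<beta> * z) * of_real (std_normal_density (\<beta> / k)) \<partial>lborel)
      = \<bar>k\<bar> *\<^sub>R (\<integral>w. iexp ((0 + k * w) * z) * of_real (std_normal_density ((0 + k * w) / k)) \<partial>lborel)"
    using assms by (intro lborel_integral_real_affine) auto
  also have "(\<integral>w. iexp ((0 + k * w) * z) * of_real (std_normal_density ((0 + k * w) / k)) \<partial>lborel)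
      = char std_normal_distribution (k * z)"
    using assms unfolding char_def
    by (subst integral_density) (auto simp: scaleR_conv_of_real ac_simps)
  finally show ?thesis
    using assms
    by (simp only: char_std_normal_distribution) (simp add: scaleR_conv_of_real std_normal_density_def)
qed

text \<open>The inversion integral with the convergence factor \<open>\<phi> (\<beta> / k m)\<close>
  is computed in two ways. Dominated convergence removes the factor up to \<open>\<phi> 0\<close>;
  Fubini turns the same integral into a Gaussian mean of \<open>f\<close> around \<open>x\<close>,
  which tends to a multiple of \<open>f x\<close>.\<close>

theorem fourier_inversion:
  fixes f :: "real \<Rightarrow> complex"
  defines "F \<equiv> (\<lambda>\<beta>. \<integral>y. iexp (\<beta> * y) * f y \<partial>lborel)"
  assumes f: "integrable lborel f" and F: "integrable lborel F" and cont: "isCont f x"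
  shows "f x = (\<integral>\<beta>. iexp (- (\<beta> * x)) * F \<beta> \<partial>lborel) / (2 * pi)"
proof -
  define \<phi> where "\<phi> = std_normal_density"
  define k where "k m = real (Suc m)" for m
  have k: "k m > 0" for m by (auto simp: k_def)
  have inf: "filterlim k at_top sequentially"
    unfolding k_def using filterlim_real_sequentially filterlim_Suc by (rule filterlim_compose)
  have [measurable]: "f \<in> borel_measurable borel" "F \<in> borel_measurable borel"
    using f F by auto
  have [measurable]: "\<phi> \<in> borel_measurable borel"
    by (simp add: \<phi>_def)
  have \<phi>_le: "\<phi> w \<le> \<phi> 0" and \<phi>_nonneg: "0 \<le> \<phi> w" for w
    by (auto simp: \<phi>_def std_normal_density_def divide_right_mono)
  have "(\<lambda>m. \<integral>\<beta>. iexp (- (\<beta> * x)) * F \<beta> * of_real (\<phi> (\<beta> / k m)) \<partial>lborel)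
      \<longlonglongrightarrow> (\<integral>\<beta>. iexp (- (\<beta> * x)) * F \<beta> * of_real (\<phi> 0) \<partial>lborel)"
  proof (rule integral_dominated_convergence[where w = "\<lambda>\<beta>. norm (F \<beta>) * \<phi> 0"])
    show "AE \<beta> in lborel. (\<lambda>m. iexp (- (\<beta> * x)) * F \<beta> * of_real (\<phi> (\<beta> / k m))) \<longlonglongrightarrow> iexp (- (\<beta> * x)) * F \<beta> * of_real (\<phi> 0)"
    proof (intro AE_I2 tendsto_intros)
      fix \<beta> :: real
      have "(\<lambda>m. \<beta> / k m) \<longlonglongrightarrow> 0"
        by (intro real_tendsto_divide_at_top[OF tendsto_const] inf)
      moreover have "isCont \<phi> 0"
        unfolding \<phi>_def std_normal_density_def by (intro continuous_intros) auto
      ultimately show "(\<lambda>m. \<phi> (\<beta> / k m)) \<longlonglongrightarrow> \<phi> 0"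
        by (rule isCont_tendsto_compose[rotated])
    qed
    show "AE \<beta> in lborel. norm (iexp (- (\<beta> * x)) * F \<beta> * of_real (\<phi> (\<beta> / k m))) \<le> norm (F \<beta>) * \<phi> 0" for m
      using \<phi>_le \<phi>_nonneg by (auto simp: norm_mult simp del: of_real_minus of_real_mult intro!: mult_left_mono)
  qed (use F in auto)
  moreover have "(\<integral>\<beta>. iexp (- (\<beta> * x)) * F \<beta> * of_real (\<phi> (\<beta> / k m)) \<partial>lborel)
      = sqrt (2 * pi) * (\<integral>y. f y * of_real (k m * \<phi> (k m * (y - x))) \<partial>lborel)" for m
  proof -
    \<comment> \<open>Without the Gaussian factor the norm of the integrand would be constant in
      \<beta>, and Fubini would not apply.\<close>
    define G where "G y \<beta> = f y * (iexp (\<beta> * (y - x)) * of_real (\<phi> (\<beta> / k m)))" for y \<beta>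
    have G_meas[measurable]: "case_prod G \<in> borel_measurable (lborel \<Otimes>\<^sub>M lborel)"
      unfolding G_def by measurable
    have nG: "norm (G y \<beta>) = norm (f y) * \<phi> (\<beta> / k m)" for y \<beta>
      using \<phi>_nonneg by (auto simp: G_def norm_mult simp del: of_real_minus of_real_mult of_real_diff)
    have \<phi>_int: "integrable lborel (\<lambda>\<beta>. \<phi> (\<beta> / k m))"
      using lborel_integrable_real_affine[of \<phi> "1 / k m" 0] k[of m] by (simp add: \<phi>_def)
    have "integrable (lborel \<Otimes>\<^sub>M lborel) (case_prod G)"
    proof (rule lborel_pair.Fubini_integrable)
      show "integrable lborel (\<lambda>y. \<integral>\<beta>. norm (case (y, \<beta>) of (y, \<beta>) \<Rightarrow> G y \<beta>) \<partial>lborel)"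
        using f by (simp add: nG)
      have "integrable lborel (G y)" for y
      proof (rule Bochner_Integration.integrable_bound)
        show "integrable lborel (\<lambda>\<beta>. norm (f y) * \<phi> (\<beta> / k m))"
          using \<phi>_int by simp
        show "G y \<in> borel_measurable lborel"
          unfolding G_def by measurable
      qed (use nG \<phi>_nonneg in auto)
      then show "AE y in lborel. integrable lborel (\<lambda>\<beta>. case (y, \<beta>) of (y, \<beta>) \<Rightarrow> G y \<beta>)"
        by simp
    qed simp
    then have "(\<integral>\<beta>. (\<integral>y. G y \<beta> \<partial>lborel) \<partial>lborel) = (\<integral>y. (\<integral>\<beta>. G y \<beta> \<partial>lborel) \<partial>lborel)"
      by (rule lborel_pair.Fubini_integral)
    moreover have "(\<integral>y. G y \<beta> \<partial>lborel) = iexp (- (\<beta> * x)) * F \<beta> * of_real (\<phi> (\<beta> / k m))" for \<beta>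
    proof -
      have "G y \<beta> = iexp (- (\<beta> * x)) * of_real (\<phi> (\<beta> / k m)) * (iexp (\<beta> * y) * f y)" for y
        by (simp add: G_def algebra_simps exp_diff exp_minus field_simps)
      then show ?thesis
        by (simp add: F_def)
    qed
    moreover have "(\<integral>\<beta>. G y \<beta> \<partial>lborel) = sqrt (2 * pi) * (f y * of_real (k m * \<phi> (k m * (y - x))))" for y
      unfolding G_def \<phi>_def using fourier_std_normal_density[OF k[of m], of "y - x"] by simp
    ultimately show ?thesis by simp
  qed
  moreover have "(\<lambda>m. sqrt (2 * pi) * (\<integral>y. f y * of_real (k m * \<phi> (k m * (y - x))) \<partial>lborel)) \<longlonglongrightarrow> sqrt (2 * pi) * f x"
    using gaussian_approximate_identity[OF f cont] unfolding \<phi>_def k_def by (intro tendsto_intros)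
  ultimately have "(\<integral>\<beta>. iexp (- (\<beta> * x)) * F \<beta> * of_real (\<phi> 0) \<partial>lborel) = sqrt (2 * pi) * f x"
    by (simp only:) (rule LIMSEQ_unique)
  \<comment> \<open>Since \<open>\<phi> 0\<close> is 1 / sqrt (2 pi), each side carries one root;
    together they form the 2 pi of the claim.\<close>
  then have "(\<integral>\<beta>. iexp (- (\<beta> * x)) * F \<beta> \<partial>lborel) / sqrt (2 * pi) = sqrt (2 * pi) * f x"
    by (simp add: \<phi>_def std_normal_density_def)
  moreover have "complex_of_real (sqrt (2 * pi)) * complex_of_real (sqrt (2 * pi)) = 2 * pi"
    unfolding of_real_mult[symmetric] by simp
  ultimately show ?thesis
    by (simp add: field_simps)
qed

section \<open>Integrability and limits of powers times exp (-t \<beta>^(2n))\<close>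

text \<open>Reduces every order to Gaussian estimates. The summand 1 pays for |\<beta>| < 1, where
  the higher power is smaller, and becomes the factor \<open>exp t\<close> in the exponential
  comparison.\<close>

lemma power2_le_even_power_add_1:
  fixes \<beta> :: real
  assumes "n \<ge> 1"
  shows "\<beta>\<^sup>2 \<le> \<beta> ^ (2 * n) + 1"
proof (cases "\<beta>\<^sup>2 \<le> 1")
  case True
  then show ?thesis by (simp add: power_mult add_increasing)
next
  case False
  then have "(\<beta>\<^sup>2) ^ 1 \<le> (\<beta>\<^sup>2) ^ n"
    using assms by (intro power_increasing) auto
  then show ?thesis by (simp add: power_mult)
qed

lemma exp_minus_even_power_le:
  fixes \<beta> :: real
  assumes "n \<ge> 1" "t > 0"
  shows "exp (- t * \<beta> ^ (2 * n)) \<le> exp t * exp (- t * \<beta>\<^sup>2)"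
proof -
  have "t * \<beta>\<^sup>2 \<le> t * (\<beta> ^ (2 * n) + 1)"
    using assms power2_le_even_power_add_1 by (intro mult_left_mono) auto
  then show ?thesis
    by (simp flip: exp_add add: algebra_simps)
qed

lemma integrable_abs_power_exp:
  assumes n: "n \<ge> 1" and t: "t > 0"
  shows "integrable lborel (\<lambda>\<beta>::real. \<bar>\<beta>\<bar> ^ k * exp (- t * \<beta> ^ (2 * n)))"
proof (rule Bochner_Integration.integrable_bound)
  \<comment> \<open>Chosen so that exp (-t \<beta>^2) is a multiple of the normal density; its
    absolute moments then give the majorant.\<close>
  define \<sigma> where "\<sigma> = 1 / sqrt (2 * t)"
  have \<sigma>: "\<sigma> > 0" "2 * \<sigma>\<^sup>2 = 1 / t"
    using t by (auto simp: \<sigma>_def power_divide)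
  then have nd: "normal_density 0 \<sigma> \<beta> = 1 / sqrt (pi / t) * exp (- t * \<beta>\<^sup>2)" for \<beta>
    using t by (simp add: normal_density_def \<sigma>_def power_divide)
  show "integrable lborel (\<lambda>\<beta>. exp t * sqrt (pi / t) * (normal_density 0 \<sigma> \<beta> * \<bar>\<beta> - 0\<bar> ^ k))"
    using integrable_normal_moment_abs[OF \<sigma>(1), of 0 k] by simp
  show "AE \<beta> in lborel. norm (\<bar>\<beta>\<bar> ^ k * exp (- t * \<beta> ^ (2 * n)))
      \<le> norm (exp t * sqrt (pi / t) * (normal_density 0 \<sigma> \<beta> * \<bar>\<beta> - 0\<bar> ^ k))"
  proof (intro AE_I2)
    fix \<beta> :: real
    have "\<bar>\<beta>\<bar> ^ k * exp (- t * \<beta> ^ (2 * n)) \<le> \<bar>\<beta>\<bar> ^ k * (exp t * exp (- t * \<beta>\<^sup>2))"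
      using exp_minus_even_power_le[OF n t] by (intro mult_left_mono) auto
    then show "norm (\<bar>\<beta>\<bar> ^ k * exp (- t * \<beta> ^ (2 * n)))
      \<le> norm (exp t * sqrt (pi / t) * (normal_density 0 \<sigma> \<beta> * \<bar>\<beta> - 0\<bar> ^ k))"
      using t by (simp add: nd abs_mult ac_simps)
  qed
qed simp

lemma integrable_power_exp_mult:
  fixes b :: "real \<Rightarrow> real"
  assumes "n \<ge> 1" "t > 0" and [measurable]: "b \<in> borel_measurable borel" and b: "\<And>\<beta>. \<bar>b \<beta>\<bar> \<le> 1"
  shows "integrable lborel (\<lambda>\<beta>. \<beta> ^ k * b \<beta> * exp (- t * \<beta> ^ (2 * n)))"
  by (rule Bochner_Integration.integrable_bound[OF integrable_abs_power_exp[OF assms(1,2), of k]])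
    (use b in \<open>auto simp: abs_mult power_abs mult_left_le intro!: mult_right_mono\<close>)

text \<open>For \<beta> \<ge> 1 the exponential is below exp (-t \<beta>), which beats every power.
  Working with |\<beta>| makes the function even, so the limit at minus infinity is a mirror
  image.\<close>

lemma power_exp_tendsto_0:
  assumes n: "n \<ge> 1" and t: "t > 0"
  shows "((\<lambda>\<beta>::real. \<beta> ^ k * exp (- t * \<beta> ^ (2 * n))) \<longlongrightarrow> 0) at_top"
    and "((\<lambda>\<beta>::real. \<beta> ^ k * exp (- t * \<beta> ^ (2 * n))) \<longlongrightarrow> 0) at_bot"
proof -
  have top: "((\<lambda>\<beta>::real. \<bar>\<beta>\<bar> ^ k * exp (- t * \<beta> ^ (2 * n))) \<longlongrightarrow> 0) at_top"
  proof (rule tendsto_sandwich[OF _ _ tendsto_const])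
    have lin: "filterlim (\<lambda>\<beta>::real. t * \<beta>) at_top at_top"
      using t by (intro filterlim_tendsto_pos_mult_at_top[OF tendsto_const]) (auto intro: filterlim_ident)
    have "((\<lambda>\<beta>. 1 / t ^ k * ((t * \<beta>) ^ k / exp (t * \<beta>))) \<longlongrightarrow> 1 / t ^ k * 0) at_top"
      by (intro tendsto_intros filterlim_compose[OF tendsto_power_div_exp_0 lin])
    then show "((\<lambda>\<beta>. 1 / t ^ k * ((t * \<beta>) ^ k / exp (t * \<beta>))) \<longlongrightarrow> 0) at_top"
      by simp
    show "\<forall>\<^sub>F \<beta> in at_top. \<bar>\<beta>\<bar> ^ k * exp (- t * \<beta> ^ (2 * n)) \<le> 1 / t ^ k * ((t * \<beta>) ^ k / exp (t * \<beta>))"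
      using eventually_ge_at_top[of 1]
    proof eventually_elim
      fix \<beta> :: real assume \<beta>: "1 \<le> \<beta>"
      then have "\<beta> ^ 1 \<le> \<beta> ^ (2 * n)"
        using n by (intro power_increasing) auto
      then have "exp (- t * \<beta> ^ (2 * n)) \<le> exp (- (t * \<beta>))"
        using t by simp
      then have "\<beta> ^ k * exp (- t * \<beta> ^ (2 * n)) \<le> \<beta> ^ k * exp (- (t * \<beta>))"
        using \<beta> by (intro mult_left_mono) auto
      then show "\<bar>\<beta>\<bar> ^ k * exp (- t * \<beta> ^ (2 * n)) \<le> 1 / t ^ k * ((t * \<beta>) ^ k / exp (t * \<beta>))"
        using \<beta> t by (simp add: power_mult_distrib exp_minus field_simps)
    qed
  qed auto
  then have bot: "((\<lambda>\<beta>::real. \<bar>\<beta>\<bar> ^ k * exp (- t * \<beta> ^ (2 * n))) \<longlongrightarrow> 0) at_bot"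
    by (subst filterlim_at_bot_mirror) (simp add: power_mult)
  show "((\<lambda>\<beta>::real. \<beta> ^ k * exp (- t * \<beta> ^ (2 * n))) \<longlongrightarrow> 0) at_top"
    by (rule tendsto_norm_zero_cancel) (use top in \<open>simp add: abs_mult power_abs\<close>)
  show "((\<lambda>\<beta>::real. \<beta> ^ k * exp (- t * \<beta> ^ (2 * n))) \<longlongrightarrow> 0) at_bot"
    by (rule tendsto_norm_zero_cancel) (use bot in \<open>simp add: abs_mult power_abs\<close>)
qed

section \<open>The kernel and its differential equation\<close>

text \<open>The \<open>k\<close>-th space derivative of the candidate \<open>(1 / 2\<pi>) \<integral> cos (\<beta>x) exp (-t \<beta>\<^sup>2\<^sup>n) d\<beta>\<close>,
  each derivative of the cosine being a phase shift by \<open>\<pi> / 2\<close>.\<close>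

definition heat_kernel_deriv :: "nat \<Rightarrow> nat \<Rightarrow> real \<Rightarrow> real \<Rightarrow> real" where
  "heat_kernel_deriv n k x t =
     (\<integral>\<beta>. \<beta> ^ k * cos (\<beta> * x + of_nat k * (pi / 2)) * exp (- t * \<beta> ^ (2 * n)) \<partial>lborel) / (2 * pi)"

abbreviation heat_kernel :: "nat \<Rightarrow> real \<Rightarrow> real \<Rightarrow> real" where
  "heat_kernel n \<equiv> heat_kernel_deriv n 0"

lemma heat_kernel_eq: "heat_kernel n x t = (\<integral>\<beta>. cos (\<beta> * x) * exp (- t * \<beta> ^ (2 * n)) \<partial>lborel) / (2 * pi)"
  by (simp add: heat_kernel_deriv_def)

lemma heat_kernel_deriv_has_derivative:
  assumes n: "n \<ge> 1" and t: "t > 0"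
  shows "((\<lambda>x. heat_kernel_deriv n k x t) has_real_derivative heat_kernel_deriv n (Suc k) x t) (at x)"
proof -
  have "((\<lambda>x. \<integral>\<beta>. \<beta> ^ k * cos (\<beta> * x + of_nat k * (pi / 2)) * exp (- t * \<beta> ^ (2 * n)) \<partial>lborel)
      has_real_derivative
      (\<integral>\<beta>. \<beta> ^ Suc k * cos (\<beta> * x + of_nat (Suc k) * (pi / 2)) * exp (- t * \<beta> ^ (2 * n)) \<partial>lborel)) (at x)"
  proof (rule has_real_derivative_integral[where S = UNIV])
    show "integrable lborel (\<lambda>\<beta>. \<bar>\<beta>\<bar> ^ Suc k * exp (- t * \<beta> ^ (2 * n)))"
      using n t by (rule integrable_abs_power_exp)
    have c: "cos (\<beta> * r + of_nat (Suc k) * (pi / 2)) = - sin (\<beta> * r + of_nat k * (pi / 2))" for \<beta> r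
      using cos_add[of "\<beta> * r + of_nat k * (pi / 2)" "pi / 2"] by (simp add: algebra_simps add_divide_distrib)
    show "((\<lambda>r. \<beta> ^ k * cos (\<beta> * r + of_nat k * (pi / 2)) * exp (- t * \<beta> ^ (2 * n))) has_real_derivative
        \<beta> ^ Suc k * cos (\<beta> * r + of_nat (Suc k) * (pi / 2)) * exp (- t * \<beta> ^ (2 * n))) (at r)" for r \<beta>
      unfolding c by (auto intro!: derivative_eq_intros)
    show "integrable lborel (\<lambda>\<beta>. \<beta> ^ k * cos (\<beta> * r + of_nat k * (pi / 2)) * exp (- t * \<beta> ^ (2 * n)))" for r
      using n t by (intro integrable_power_exp_mult) auto
    show "\<bar>\<beta> ^ Suc k * cos (\<beta> * r + of_nat (Suc k) * (pi / 2)) * exp (- t * \<beta> ^ (2 * n))\<bar>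
        \<le> \<bar>\<beta>\<bar> ^ Suc k * exp (- t * \<beta> ^ (2 * n))" for r \<beta>
      unfolding abs_mult power_abs by (intro mult_mono mult_left_le) (auto simp: abs_mult)
  qed auto
  then show ?thesis
    unfolding heat_kernel_deriv_def by (rule DERIV_cdivide)
qed

lemma deriv_funpow_heat_kernel:
  assumes n: "n \<ge> 1" and t: "t > 0"
  shows "(deriv ^^ k) (\<lambda>y. heat_kernel n y t) = (\<lambda>y. heat_kernel_deriv n k y t)"
proof (induction k)
  case (Suc k)
  then show ?case
    using heat_kernel_deriv_has_derivative[OF assms] by (auto intro!: DERIV_imp_deriv)
qed simp

text \<open>The majorant must not depend on the time: for r > t / 2 the exponential with rate r is
  below the one with rate t / 2. On all r > 0 the supremum of the integrands would involve
  \<beta>^(2n) without decay.\<close>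

lemma heat_kernel_has_time_derivative:
  assumes n: "n \<ge> 1" and t: "t > 0"
  shows "((\<lambda>s. heat_kernel n x s) has_real_derivative (-1) ^ (n + 1) * heat_kernel_deriv n (2 * n) x t) (at t)"
proof -
  have "((\<lambda>s. \<integral>\<beta>. cos (\<beta> * x) * exp (- s * \<beta> ^ (2 * n)) \<partial>lborel) has_real_derivative
      (\<integral>\<beta>. cos (\<beta> * x) * (- (\<beta> ^ (2 * n)) * exp (- t * \<beta> ^ (2 * n))) \<partial>lborel)) (at t)"
  proof (rule has_real_derivative_integral[where S = "{t / 2<..}"])
    show "integrable lborel (\<lambda>\<beta>. \<bar>\<beta>\<bar> ^ (2 * n) * exp (- (t / 2) * \<beta> ^ (2 * n)))"
      using n t by (intro integrable_abs_power_exp) auto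
    show "((\<lambda>s. cos (\<beta> * x) * exp (- s * \<beta> ^ (2 * n))) has_real_derivative
        cos (\<beta> * x) * (- (\<beta> ^ (2 * n)) * exp (- r * \<beta> ^ (2 * n)))) (at r)" for r \<beta>
      by (auto intro!: derivative_eq_intros)
    show "integrable lborel (\<lambda>\<beta>. cos (\<beta> * x) * exp (- r * \<beta> ^ (2 * n)))" if "r \<in> {t / 2<..}" for r
      using integrable_power_exp_mult[OF n, of r "\<lambda>\<beta>. cos (\<beta> * x)" 0] that t by simp
    show "\<bar>cos (\<beta> * x) * (- (\<beta> ^ (2 * n)) * exp (- r * \<beta> ^ (2 * n)))\<bar>
        \<le> \<bar>\<beta>\<bar> ^ (2 * n) * exp (- (t / 2) * \<beta> ^ (2 * n))" if "r \<in> {t / 2<..}" for r \<beta>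
    proof -
      have "exp (- r * \<beta> ^ (2 * n)) \<le> exp (- (t / 2) * \<beta> ^ (2 * n))"
        using that mult_right_mono[of "t / 2" r "\<beta> ^ (2 * n)"] by simp
      then have "\<bar>cos (\<beta> * x)\<bar> * (\<bar>\<beta>\<bar> ^ (2 * n) * exp (- r * \<beta> ^ (2 * n)))
          \<le> 1 * (\<bar>\<beta>\<bar> ^ (2 * n) * exp (- (t / 2) * \<beta> ^ (2 * n)))"
        by (intro mult_mono) auto
      then show ?thesis by (simp add: abs_mult power_abs)
    qed
  qed (use t in auto)
  moreover have "(\<integral>\<beta>. cos (\<beta> * x) * (- (\<beta> ^ (2 * n)) * exp (- t * \<beta> ^ (2 * n))) \<partial>lborel) / (2 * pi)
      = (-1) ^ (n + 1) * heat_kernel_deriv n (2 * n) x t"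
  proof -
    \<comment> \<open>The 2n quarter turns add up to n pi, hence (-1)^n; the remaining sign in
      (-1)^(n+1) comes from differentiating the exponential in time.\<close>
    have "cos (\<beta> * x + real (2 * n) * (pi / 2)) = (-1) ^ n * cos (\<beta> * x)" for \<beta>
      by (simp add: cos_add mult.commute)
    then have eq: "(-1) ^ (n + 1) * (\<beta> ^ (2 * n) * cos (\<beta> * x + real (2 * n) * (pi / 2)) * exp (- t * \<beta> ^ (2 * n)))
        = cos (\<beta> * x) * (- (\<beta> ^ (2 * n)) * exp (- t * \<beta> ^ (2 * n)))" for \<beta>
      by (simp flip: power_add mult_2)
    show ?thesis
      unfolding eq[symmetric] heat_kernel_deriv_def integral_mult_right_zero times_divide_eq_right
      by (rule refl)
  qed
  ultimately show ?thesis
    unfolding heat_kernel_eq by (auto dest: DERIV_cdivide[where c = "2 * pi"])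
qed

lemma classical_solution_heat_kernel:
  assumes "n \<ge> 1"
  shows "classical_solution n (heat_kernel n)"
  unfolding classical_solution_def
  using heat_kernel_deriv_has_derivative[OF assms] heat_kernel_has_time_derivative[OF assms]
  by (auto simp: deriv_funpow_heat_kernel[OF assms] simp: real_differentiable_def)

section \<open>Decay and integrability of the kernel\<close>

lemma integrable_inverse_1_plus_square_lborel: "integrable lborel (\<lambda>x::real. inverse (1 + x\<^sup>2))"
  using integrable_inverse_1_plus_square by (simp add: set_integrable_def)

text \<open>For the cosine integral I, absolute values give |I| \<le> C0, while moving two
  derivatives onto the exponential gives x^2 |I| \<le> C2. Adding the two avoids a case split at x =
  0 and yields the integrable majorant 1 / (1 + x^2).\<close>

lemma heat_kernel_decay:
  assumes n: "n \<ge> 1" and t: "t > 0"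
  obtains C where "\<And>x. \<bar>heat_kernel n x t\<bar> \<le> C * inverse (1 + x\<^sup>2)"
proof -
  define g where "g \<beta> = exp (- t * \<beta> ^ (2 * n))" for \<beta>
  define a where "a = t * real (2 * n)"
  define g' where "g' \<beta> = - a * (\<beta> ^ (2 * n - 1) * g \<beta>)" for \<beta>
  define g'' where "g'' \<beta> = - a * (real (2 * n - 1) * (\<beta> ^ (2 * n - 2) * g \<beta>) - a * (\<beta> ^ (2 * (2 * n - 1)) * g \<beta>))" for \<beta>
  have g: "(g has_real_derivative g' \<beta>) (at \<beta>)" for \<beta>
    unfolding g_def g'_def a_def by (auto intro!: derivative_eq_intros)
  have g': "(g' has_real_derivative g'' \<beta>) (at \<beta>)" for \<beta>
  proof -
    have "(g' has_real_derivative
        - a * (real (2 * n - 1) * \<beta> ^ (2 * n - 1 - 1) * g \<beta> + \<beta> ^ (2 * n - 1) * g' \<beta>)) (at \<beta>)"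
      unfolding g'_def by (rule derivative_eq_intros refl g[unfolded g'_def] | simp)+
    moreover have "- a * (real (2 * n - 1) * \<beta> ^ (2 * n - 1 - 1) * g \<beta> + \<beta> ^ (2 * n - 1) * g' \<beta>) = g'' \<beta>"
    proof -
      have *: "\<beta> ^ (2 * (2 * n - 1)) = \<beta> ^ (2 * n - 1) * \<beta> ^ (2 * n - 1)"
        by (simp only: mult_2[of "2 * n - 1"] power_add)
      show ?thesis
        unfolding g'_def g''_def * diff_diff_left one_add_one by (simp only: algebra_simps)
    qed
    ultimately show ?thesis by simp
  qed
  have cg: "isCont g'' \<beta>" "isCont g \<beta>" for \<beta> :: real
    unfolding g''_def g_def by (intro continuous_intros)+
  have meas[measurable]: "g \<in> borel_measurable borel"
    unfolding g_def by measurable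
  have int: "integrable lborel (\<lambda>\<beta>. \<beta> ^ k * b \<beta> * g \<beta>)"
    if "b \<in> borel_measurable borel" "\<And>\<beta>. \<bar>b \<beta>\<bar> \<le> 1" for b k
    unfolding g_def using n t that by (rule integrable_power_exp_mult)
  have int_g'': "integrable lborel (\<lambda>\<beta>. g'' \<beta> * b \<beta>)"
    if "b \<in> borel_measurable borel" "\<And>\<beta>. \<bar>b \<beta>\<bar> \<le> 1" for b
  proof -
    have "integrable lborel (\<lambda>\<beta>. - a * (real (2 * n - 1) * (\<beta> ^ (2 * n - 2) * b \<beta> * g \<beta>) - a * (\<beta> ^ (2 * (2 * n - 1)) * b \<beta> * g \<beta>)))"
      by (intro integrable_mult_right Bochner_Integration.integrable_diff int that)
    then show ?thesis
      by (rule Bochner_Integration.integrable_cong[THEN iffD1, rotated -1]) (auto simp: g''_def algebra_simps)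
  qed
  have lim: "((\<lambda>\<beta>. \<beta> ^ k * g \<beta>) \<longlongrightarrow> 0) at_top" "((\<lambda>\<beta>. \<beta> ^ k * g \<beta>) \<longlongrightarrow> 0) at_bot" for k
    unfolding g_def using power_exp_tendsto_0[OF n t] by auto
  have bdd: "((\<lambda>\<beta>. f \<beta> * b \<beta>) \<longlongrightarrow> 0) A"
    if "(f \<longlongrightarrow> 0) A" "\<And>\<beta>. \<bar>b \<beta>\<bar> \<le> 1" for f b :: "real \<Rightarrow> real" and A
    by (rule Lim_null_comparison[OF always_eventually tendsto_norm_zero[OF that(1)]])
      (use that(2) in \<open>auto simp: abs_mult mult_left_le\<close>)
  have key: "(\<integral>\<beta>. g'' \<beta> * cos (\<beta> * x) \<partial>lborel) = - x\<^sup>2 * (\<integral>\<beta>. cos (\<beta> * x) * g \<beta> \<partial>lborel)" for x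
  proof -
    have ib: "integrable lborel (\<lambda>\<beta>. g'' \<beta> * cos (\<beta> * x))" "integrable lborel (\<lambda>\<beta>. cos (\<beta> * x) * g \<beta>)"
      using int_g''[of "\<lambda>\<beta>. cos (\<beta> * x)"] int[of "\<lambda>\<beta>. cos (\<beta> * x)" 0] by auto
    have "(\<integral>\<beta>. g'' \<beta> * cos (\<beta> * x) + x\<^sup>2 * (cos (\<beta> * x) * g \<beta>) \<partial>lborel) = 0"
    \<comment> \<open>This \<open>F\<close> holds the boundary terms of both integrations by parts;
      the mixed terms x g' sin cancel in its derivative.\<close>
    proof (rule integral_derivative_UNIV_eq_0[where F = "\<lambda>\<beta>. g' \<beta> * cos (\<beta> * x) + x * (g \<beta> * sin (\<beta> * x))"])
      show "((\<lambda>\<beta>. g' \<beta> * cos (\<beta> * x) + x * (g \<beta> * sin (\<beta> * x))) has_real_derivative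
          g'' \<beta> * cos (\<beta> * x) + x\<^sup>2 * (cos (\<beta> * x) * g \<beta>)) (at \<beta>)" for \<beta>
        by (rule derivative_eq_intros g g' refl | simp add: power2_eq_square algebra_simps)+
      have gl: "(g \<longlongrightarrow> 0) at_top" "(g \<longlongrightarrow> 0) at_bot"
        using lim[of 0] by auto
      have g'l: "(g' \<longlongrightarrow> 0) at_top" "(g' \<longlongrightarrow> 0) at_bot"
        unfolding g'_def by (intro tendsto_mult_right_zero lim)+
      show "((\<lambda>\<beta>. g' \<beta> * cos (\<beta> * x) + x * (g \<beta> * sin (\<beta> * x))) \<longlongrightarrow> 0) at_top"
           "((\<lambda>\<beta>. g' \<beta> * cos (\<beta> * x) + x * (g \<beta> * sin (\<beta> * x))) \<longlongrightarrow> 0) at_bot"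
        by (intro tendsto_add_zero tendsto_mult_right_zero bdd gl g'l; simp)+
    qed (use ib cg in \<open>auto intro!: continuous_intros\<close>)
    then show ?thesis using ib by simp
  qed
  define C0 where "C0 = (\<integral>\<beta>. g \<beta> \<partial>lborel)"
  define C2 where "C2 = (\<integral>\<beta>. \<bar>g'' \<beta>\<bar> \<partial>lborel)"
  have "\<bar>heat_kernel n x t\<bar> \<le> (C0 + C2) / (2 * pi) * inverse (1 + x\<^sup>2)" for x
  proof -
    define I where "I = (\<integral>\<beta>. cos (\<beta> * x) * g \<beta> \<partial>lborel)"
    have "\<bar>I\<bar> \<le> C0"
      unfolding I_def C0_def
    proof (rule integral_abs_bound_integral)
      show "integrable lborel (\<lambda>\<beta>. cos (\<beta> * x) * g \<beta>)" "integrable lborel g"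
        using int[of "\<lambda>\<beta>. cos (\<beta> * x)" 0] int[of "\<lambda>_. 1" 0] by auto
    qed (auto simp: abs_mult g_def)
    moreover have "\<bar>\<integral>\<beta>. g'' \<beta> * cos (\<beta> * x) \<partial>lborel\<bar> \<le> C2"
      unfolding C2_def
      by (rule integral_abs_bound_integral)
        (use int_g''[of "\<lambda>\<beta>. cos (\<beta> * x)"] int_g''[of "\<lambda>_. 1"] in \<open>auto simp: abs_mult mult_left_le\<close>)
    then have "x\<^sup>2 * \<bar>I\<bar> \<le> C2"
      by (simp add: key I_def abs_mult)
    ultimately have "(1 + x\<^sup>2) * \<bar>I\<bar> \<le> C0 + C2"
      by (simp add: algebra_simps)
    moreover have "1 + x\<^sup>2 > 0" by (simp add: add_pos_nonneg)
    ultimately have "\<bar>I\<bar> \<le> (C0 + C2) * inverse (1 + x\<^sup>2)"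
      by (simp add: field_simps)
    then have "\<bar>I\<bar> / (2 * pi) \<le> (C0 + C2) * inverse (1 + x\<^sup>2) / (2 * pi)"
      by (rule divide_right_mono) simp
    then show ?thesis
      by (simp add: heat_kernel_eq I_def g_def)
  qed
  then show thesis by (rule that)
qed

lemma heat_kernel_borel_measurable:
  assumes n: "n \<ge> 1" and t: "t > 0"
  shows "(\<lambda>x. heat_kernel n x t) \<in> borel_measurable borel"
  by (intro borel_measurable_continuous_onI continuous_at_imp_continuous_on ballI
      DERIV_isCont[OF heat_kernel_deriv_has_derivative[OF assms]])

lemma integrable_heat_kernel:
  assumes n: "n \<ge> 1" and t: "t > 0"
  shows "integrable lborel (\<lambda>x. heat_kernel n x t)"
proof -
  obtain C where C: "\<And>x. \<bar>heat_kernel n x t\<bar> \<le> C * inverse (1 + x\<^sup>2)"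
    using heat_kernel_decay[OF assms] by blast
  show ?thesis
  proof (rule Bochner_Integration.integrable_bound)
    show "integrable lborel (\<lambda>x. C * inverse (1 + x\<^sup>2))"
      using integrable_inverse_1_plus_square_lborel by simp
    show "AE x in lborel. norm (heat_kernel n x t) \<le> norm (C * inverse (1 + x\<^sup>2))"
      using C by (metis (mono_tags, lifting) AE_I2 abs_le_D1 abs_ge_self order_trans real_norm_def)
  qed (use heat_kernel_borel_measurable[OF assms] in simp)
qed

section \<open>Fourier transform and initial value of the kernel\<close>

text \<open>Reflection shows that the integral equals its own negative; the default value 0 for
  non-integrable functions is consistent with this.\<close>

lemma integral_odd_function:
  fixes f :: "real \<Rightarrow> real"
  assumes "\<And>x. f (- x) = - f x"
  shows "(\<integral>x. f x \<partial>lborel) = 0"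
  using lborel_integral_real_affine[of "-1" f 0] by (simp add: assms)

lemma fourier_exp_even_power:
  assumes n: "n \<ge> 1" and t: "t > 0"
  shows "(\<integral>\<beta>. iexp (x * \<beta>) * of_real (exp (- t * \<beta> ^ (2 * n))) \<partial>lborel) = of_real (2 * pi * heat_kernel n x t)"
proof -
  define g where "g \<beta> = exp (- t * \<beta> ^ (2 * n))" for \<beta>
  have int: "integrable lborel (\<lambda>\<beta>. cos (x * \<beta>) * g \<beta>)" "integrable lborel (\<lambda>\<beta>. sin (x * \<beta>) * g \<beta>)"
    using integrable_power_exp_mult[OF assms, of "\<lambda>\<beta>. cos (x * \<beta>)" 0]
      integrable_power_exp_mult[OF assms, of "\<lambda>\<beta>. sin (x * \<beta>)" 0] by (simp_all add: g_def)
  have "iexp (x * \<beta>) * of_real (g \<beta>)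
      = of_real (cos (x * \<beta>) * g \<beta>) + \<i> * of_real (sin (x * \<beta>) * g \<beta>)" for \<beta>
    by (simp only: cis_conv_exp[symmetric]) (simp add: complex_eq_iff)
  then have "(\<integral>\<beta>. iexp (x * \<beta>) * of_real (g \<beta>) \<partial>lborel)
      = of_real (\<integral>\<beta>. cos (x * \<beta>) * g \<beta> \<partial>lborel) + \<i> * of_real (\<integral>\<beta>. sin (x * \<beta>) * g \<beta> \<partial>lborel)"
    using int by (simp del: of_real_mult)
  also have "(\<integral>\<beta>. sin (x * \<beta>) * g \<beta> \<partial>lborel) = 0"
    by (rule integral_odd_function) (simp add: g_def power_mult)
  also have "(\<integral>\<beta>. cos (x * \<beta>) * g \<beta> \<partial>lborel) = 2 * pi * heat_kernel n x t"
    by (simp add: heat_kernel_eq g_def mult.commute)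
  finally show ?thesis by (simp add: g_def)
qed

lemma heat_kernel_minus: "heat_kernel n (- x) t = heat_kernel n x t"
  by (simp add: heat_kernel_eq)

text \<open>Inversion with the roles exchanged: the function is the exponential \<open>g\<close>,
  and its transform is 2 pi times the kernel, integrable by the decay estimate. Evaluating at
  -\<beta> turns the kernel exp (-i x \<beta>) of the inversion formula into exp (i x \<beta>), and
  \<open>g\<close> is even.\<close>

lemma fourier_heat_kernel:
  assumes n: "n \<ge> 1" and t: "t > 0"
  shows "(\<integral>x. iexp (\<beta> * x) * of_real (heat_kernel n x t) \<partial>lborel) = of_real (exp (- t * \<beta> ^ (2 * n)))"
proof -
  define g where "g = (\<lambda>\<beta>. complex_of_real (exp (- t * \<beta> ^ (2 * n))))"
  have F: "(\<integral>y. iexp (\<xi> * y) * g y \<partial>lborel) = of_real (2 * pi * heat_kernel n \<xi> t)" for \<xi>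
    unfolding g_def by (rule fourier_exp_even_power[OF assms])
  have "g (- \<beta>) = (\<integral>\<xi>. iexp (- (\<xi> * (- \<beta>))) * (\<integral>y. iexp (\<xi> * y) * g y \<partial>lborel) \<partial>lborel) / (2 * pi)"
  proof (rule fourier_inversion)
    show "integrable lborel g"
      using integrable_power_exp_mult[OF assms, of "\<lambda>_. 1" 0] by (simp add: g_def)
    show "integrable lborel (\<lambda>\<xi>. \<integral>y. iexp (\<xi> * y) * g y \<partial>lborel)"
      unfolding F using integrable_heat_kernel[OF assms] by simp
    show "isCont g (- \<beta>)"
      unfolding g_def by (intro continuous_intros)
  qed
  also have "\<dots> = (\<integral>x. iexp (\<beta> * x) * of_real (heat_kernel n x t) \<partial>lborel)"
    unfolding F by (simp add: mult.left_commute mult.commute)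
  finally show ?thesis
    by (simp add: g_def power_mult)
qed

text \<open>Substituting \<beta> / r for \<beta> removes \<open>t\<close> from the exponent, so that
  all times reduce to time 1.\<close>

lemma heat_kernel_scaling:
  assumes r: "r > 0" "r ^ (2 * n) = t"
  shows "heat_kernel n x t = heat_kernel n (x / r) 1 / r"
proof -
  have "(\<integral>\<beta>. cos (\<beta> * x) * exp (- t * \<beta> ^ (2 * n)) \<partial>lborel)
      = \<bar>1 / r\<bar> *\<^sub>R (\<integral>\<beta>. cos ((0 + 1 / r * \<beta>) * x) * exp (- t * (0 + 1 / r * \<beta>) ^ (2 * n)) \<partial>lborel)"
    using r by (intro lborel_integral_real_affine) auto
  also have "\<dots> = (\<integral>\<beta>. cos (\<beta> * (x / r)) * exp (- 1 * \<beta> ^ (2 * n)) \<partial>lborel) / r"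
    using r by (auto simp: power_divide)
  finally show ?thesis by (simp add: heat_kernel_eq)
qed

text \<open>After rescaling, time enters only through the argument of the test function, so a bound
  of that function times the absolute kernel at time 1 dominates for all times.\<close>

lemma initial_delta_heat_kernel:
  assumes n: "n \<ge> 1"
  shows "initial_delta (heat_kernel n)"
  unfolding initial_delta_def
proof (intro allI impI)
  fix \<phi> :: "real \<Rightarrow> real"
  assume cont: "continuous_on UNIV \<phi>" and "bounded (range \<phi>)"
  then obtain B where B: "\<And>x. \<bar>\<phi> x\<bar> \<le> B"
    by (auto simp: bounded_iff)
  have [measurable]: "\<phi> \<in> borel_measurable borel"
    using cont by (rule borel_measurable_continuous_onI)
  have int: "integrable lborel (\<lambda>y. heat_kernel n y 1)"
    using integrable_heat_kernel[OF n] by simp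
  then have [measurable]: "(\<lambda>y. heat_kernel n y 1) \<in> borel_measurable borel"
    using borel_measurable_integrable by fastforce
  \<comment> \<open>The total mass is the Fourier transform at frequency 0.\<close>
  have "complex_of_real (\<integral>y. heat_kernel n y 1 \<partial>lborel) = 1"
    using fourier_heat_kernel[OF n, of 1 0] n by simp
  then have one: "(\<integral>y. heat_kernel n y 1 \<partial>lborel) = 1"
    by (simp only: of_real_eq_1_iff)
  have scaled: "(\<integral>x. \<phi> x * heat_kernel n x t \<partial>lborel) = (\<integral>y. \<phi> (root (2 * n) t * y) * heat_kernel n y 1 \<partial>lborel)"
    if "t > 0" for t
  proof -
    define r where "r = root (2 * n) t"
    have r: "r > 0" "r ^ (2 * n) = t"
      using n that by (auto simp: r_def)
    have "(\<integral>x. \<phi> x * heat_kernel n x t \<partial>lborel)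
        = \<bar>r\<bar> *\<^sub>R (\<integral>y. \<phi> (0 + r * y) * heat_kernel n (0 + r * y) t \<partial>lborel)"
      using r by (intro lborel_integral_real_affine) auto
    also have "\<dots> = (\<integral>y. r * (\<phi> (r * y) * (heat_kernel n y 1 / r)) \<partial>lborel)"
      using r by (simp add: heat_kernel_scaling[OF r, of "r * _"])
    finally show ?thesis
      using r by (simp flip: r_def)
  qed
  show "((\<lambda>t. \<integral>x. \<phi> x * heat_kernel n x t \<partial>lborel) \<longlongrightarrow> \<phi> 0) (at_right 0)"
    unfolding tendsto_at_iff_sequentially comp_def
  proof (intro allI impI)
    fix X :: "nat \<Rightarrow> real" assume X: "\<forall>i. X i \<in> {0<..} - {0}" "X \<longlonglongrightarrow> 0"
    have "(\<lambda>i. \<integral>y. \<phi> (root (2 * n) (X i) * y) * heat_kernel n y 1 \<partial>lborel)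
        \<longlonglongrightarrow> (\<integral>y. \<phi> 0 * heat_kernel n y 1 \<partial>lborel)"
    proof (rule integral_dominated_convergence[where w = "\<lambda>y. B * \<bar>heat_kernel n y 1\<bar>"])
      show "AE y in lborel. (\<lambda>i. \<phi> (root (2 * n) (X i) * y) * heat_kernel n y 1) \<longlonglongrightarrow> \<phi> 0 * heat_kernel n y 1"
      proof (intro AE_I2 tendsto_intros)
        fix y
        have "(\<lambda>i. root (2 * n) (X i) * y) \<longlonglongrightarrow> root (2 * n) 0 * y"
          by (intro tendsto_intros X)
        moreover have "isCont \<phi> 0"
          using cont by (simp add: continuous_on_eq_continuous_at)
        ultimately show "(\<lambda>i. \<phi> (root (2 * n) (X i) * y)) \<longlonglongrightarrow> \<phi> 0"
          by (intro isCont_tendsto_compose[of 0 \<phi>]) auto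
      qed
      show "AE y in lborel. norm (\<phi> (root (2 * n) (X i) * y) * heat_kernel n y 1) \<le> B * \<bar>heat_kernel n y 1\<bar>" for i
        using B by (auto simp: abs_mult intro!: mult_right_mono)
    qed (use int in auto)
    moreover have "(\<integral>x. \<phi> x * heat_kernel n x (X i) \<partial>lborel)
        = (\<integral>y. \<phi> (root (2 * n) (X i) * y) * heat_kernel n y 1 \<partial>lborel)" for i
      using X by (intro scaled) auto
    ultimately show "(\<lambda>i. \<integral>x. \<phi> x * heat_kernel n x (X i) \<partial>lborel) \<longlonglongrightarrow> \<phi> 0"
      by (simp add: one)
  qed
qed

section \<open>Existence and uniqueness of the fundamental solution\<close>

lemma fundamental_solution_heat_kernel:
  assumes "n \<ge> 1"
  shows "fundamental_solution n (heat_kernel n)"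
  unfolding fundamental_solution_def
  using classical_solution_heat_kernel[OF assms] initial_delta_heat_kernel[OF assms]
    integrable_heat_kernel[OF assms] fourier_heat_kernel[OF assms] by blast

text \<open>The clause of order 0 in \<open>classical_solution\<close> is available because 0 < 2n.
  It supplies the continuity that inversion requires at each point, and later the limit at x =
  0.\<close>

lemma fundamental_solution_isCont:
  assumes "fundamental_solution n u" "n \<ge> 1" "t > 0"
  shows "isCont (\<lambda>y. u y t) x"
proof -
  have "(deriv ^^ 0) (\<lambda>y. u y t) differentiable (at x)"
    using assms unfolding fundamental_solution_def classical_solution_def by fastforce
  then show ?thesis
    by (simp add: differentiable_imp_continuous_within)
qed

lemma fundamental_solution_eq_heat_kernel:
  assumes u: "fundamental_solution n u" and n: "n \<ge> 1" and t: "t > 0"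
  shows "u x t = heat_kernel n x t"
proof -
  have int: "integrable lborel (\<lambda>x. u x t)"
    and F: "(\<integral>y. iexp (\<beta> * y) * of_real (u y t) \<partial>lborel) = of_real (exp (- t * \<beta> ^ (2 * n)))" for \<beta>
    using u t unfolding fundamental_solution_def by auto
  have "complex_of_real (u x t)
      = (\<integral>\<beta>. iexp (- (\<beta> * x)) * (\<integral>y. iexp (\<beta> * y) * of_real (u y t) \<partial>lborel) \<partial>lborel) / (2 * pi)"
  proof (rule fourier_inversion)
    show "integrable lborel (\<lambda>x. complex_of_real (u x t))"
      using int by simp
    show "integrable lborel (\<lambda>\<beta>. \<integral>y. iexp (\<beta> * y) * of_real (u y t) \<partial>lborel)"
      unfolding F using integrable_power_exp_mult[OF n t, of "\<lambda>_. 1" 0] by simp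
    show "isCont (\<lambda>x. complex_of_real (u x t)) x"
      using fundamental_solution_isCont[OF u n t] by (intro continuous_intros)
  qed
  also have "\<dots> = (\<integral>\<beta>. iexp (- x * \<beta>) * of_real (exp (- t * \<beta> ^ (2 * n))) \<partial>lborel) / (2 * pi)"
    unfolding F by (simp add: mult.commute)
  also have "\<dots> = of_real (heat_kernel n x t)"
    unfolding fourier_exp_even_power[OF n t] heat_kernel_minus by simp
  finally show ?thesis
    by (simp only: of_real_eq_iff)
qed

section \<open>The generalized gamma expectation\<close>

text \<open>With parameter 1 / t the density is minus the derivative of exp (-t \<beta>^(2n)) on the
  positive half-line. Its formula times the sine extends to an even function \<open>h\<close> on the
  line, an odd power times an odd function, so whole-line integration by parts applies and halving
  turns 2 pi into pi.\<close>

lemma integral_sin_gen_gamma: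
  assumes n: "n \<ge> 1" and t: "t > 0"
  shows "(\<integral>y. gen_gamma_density (real (2 * n)) y (1 / t) * sin (x * y) \<partial>lborel) = pi * x * heat_kernel n x t"
proof -
  define g where "g \<beta> = exp (- t * \<beta> ^ (2 * n))" for \<beta>
  define a where "a = t * real (2 * n)"
  define h where "h \<beta> = a * (\<beta> ^ (2 * n - 1) * sin (x * \<beta>) * g \<beta>)" for \<beta>
  have cos_int: "integrable lborel (\<lambda>\<beta>. cos (\<beta> * x) * g \<beta>)"
    using integrable_power_exp_mult[OF assms, of "\<lambda>\<beta>. cos (\<beta> * x)" 0] by (simp add: g_def)
  have h_int: "integrable lborel h"
    unfolding h_def g_def by (intro integrable_mult_right integrable_power_exp_mult assms) auto
  have "(\<integral>\<beta>. x * (cos (\<beta> * x) * g \<beta>) - h \<beta> \<partial>lborel) = 0"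
  proof (rule integral_derivative_UNIV_eq_0[where F = "\<lambda>\<beta>. g \<beta> * sin (x * \<beta>)"])
    show "((\<lambda>\<beta>. g \<beta> * sin (x * \<beta>)) has_real_derivative x * (cos (\<beta> * x) * g \<beta>) - h \<beta>) (at \<beta>)" for \<beta>
      unfolding g_def h_def a_def by (auto intro!: derivative_eq_intros simp: algebra_simps)
    show "isCont (\<lambda>\<beta>. x * (cos (\<beta> * x) * g \<beta>) - h \<beta>) \<beta>" for \<beta>
      unfolding g_def h_def by (intro continuous_intros)
    have bdd: "((\<lambda>\<beta>. g \<beta> * sin (x * \<beta>)) \<longlongrightarrow> 0) A" if "(g \<longlongrightarrow> 0) A" for A
      by (rule Lim_null_comparison[OF always_eventually tendsto_norm_zero[OF that]])
        (auto simp: abs_mult mult_left_le)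
    have "(g \<longlongrightarrow> 0) at_top" "(g \<longlongrightarrow> 0) at_bot"
      using power_exp_tendsto_0[OF assms, of 0] by (simp_all add: g_def[abs_def])
    then show "((\<lambda>\<beta>. g \<beta> * sin (x * \<beta>)) \<longlongrightarrow> 0) at_top" "((\<lambda>\<beta>. g \<beta> * sin (x * \<beta>)) \<longlongrightarrow> 0) at_bot"
      by (auto intro: bdd)
  qed (use cos_int h_int in auto)
  then have h: "(\<integral>\<beta>. h \<beta> \<partial>lborel) = x * (2 * pi * heat_kernel n x t)"
    using cos_int h_int by (simp add: heat_kernel_eq g_def)
  \<comment> \<open>The density is cut off at y > 0 while the indicator includes 0; both sides
    vanish there because sin 0 = 0.\<close>
  have eq: "gen_gamma_density (real (2 * n)) y (1 / t) * sin (x * y) = indicator {0..} y *\<^sub>R h y" for y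
  proof (cases "y > 0")
    case True
    have "real (2 * n) - 1 = real (2 * n - 1)"
      using n by simp
    then have "y powr (real (2 * n) - 1) = y ^ (2 * n - 1)" "y powr real (2 * n) = y ^ (2 * n)"
      using True by (simp_all only: powr_realpow)
    then show ?thesis
      using True by (simp only: gen_gamma_density_def) (simp add: h_def g_def a_def mult_ac)
  next
    case False
    then show ?thesis by (cases "y = 0") (auto simp: gen_gamma_density_def h_def)
  qed
  define E where "E = (\<integral>y. indicator {0..} y *\<^sub>R h y \<partial>lborel)"
  have "has_bochner_integral lborel h (2 *\<^sub>R E)"
  proof (rule has_bochner_integral_even_function)
    show "has_bochner_integral lborel (\<lambda>y. indicator {0..} y *\<^sub>R h y) E"
      unfolding E_def using h_int
      by (intro has_bochner_integral_integrable integrable_mult_indicator) auto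
    show "h (- \<beta>) = h \<beta>" for \<beta>
      using n by (simp add: h_def g_def power_mult)
  qed
  then have "(\<integral>\<beta>. h \<beta> \<partial>lborel) = 2 * E"
    by (simp add: has_bochner_integral_integral_eq)
  then show ?thesis
    unfolding eq E_def[symmetric] using h by (simp add: mult_ac)
qed

theorem theorem2p6:
  fixes n :: nat
  assumes "n \<ge> 1"
  shows "(\<exists>u. fundamental_solution n u) \<and>
    (\<forall>u (t::real) (M::'a measure) (G::'a \<Rightarrow> real).
       fundamental_solution n u \<longrightarrow> t > 0 \<longrightarrow> prob_space M \<longrightarrow>
       distributed M lborel G (\<lambda>y. ennreal (gen_gamma_density (real (2 * n)) y (1 / t))) \<longrightarrow>
         (\<forall>x. x \<noteq> 0 \<longrightarrow> u x t = 1 / (pi * x) * (\<integral>\<omega>. sin (x * G \<omega>) \<partial>M)) \<and>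
         ((\<lambda>x. 1 / (pi * x) * (\<integral>\<omega>. sin (x * G \<omega>) \<partial>M)) \<longlongrightarrow> u 0 t) (at 0))"
proof (intro conjI allI impI)
  show "\<exists>u. fundamental_solution n u"
    using fundamental_solution_heat_kernel[OF assms] by blast
next
  fix u t and M :: "'a measure" and G :: "'a \<Rightarrow> real"
  assume u: "fundamental_solution n u" and t: "t > 0"
    and G: "distributed M lborel G (\<lambda>y. ennreal (gen_gamma_density (real (2 * n)) y (1 / t)))"
  have "(\<integral>\<omega>. sin (x * G \<omega>) \<partial>M) = pi * x * heat_kernel n x t" for x
  proof -
    have "(\<integral>y. gen_gamma_density (real (2 * n)) y (1 / t) * sin (x * y) \<partial>lborel)
        = (\<integral>\<omega>. sin (x * G \<omega>) \<partial>M)"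
      using t by (intro distributed_integral[OF G]) (auto simp: gen_gamma_density_def)
    then show ?thesis
      using integral_sin_gen_gamma[OF assms t] by simp
  qed
  then have eq: "1 / (pi * x) * (\<integral>\<omega>. sin (x * G \<omega>) \<partial>M) = u x t" if "x \<noteq> 0" for x
    using that fundamental_solution_eq_heat_kernel[OF u assms t] by simp
  then show "u x t = 1 / (pi * x) * (\<integral>\<omega>. sin (x * G \<omega>) \<partial>M)" if "x \<noteq> 0" for x
    using that by simp
  \<comment> \<open>At x = 0 division by zero would make the formula 0, whereas \<open>u 0 t\<close>
    is positive as the integral of an exponential. The value is recovered as a limit: off 0 the
    formula is \<open>u x t\<close>, which is continuous in x.\<close>
  have "((\<lambda>x. u x t) \<longlongrightarrow> u 0 t) (at 0)"
    using fundamental_solution_isCont[OF u assms t] by (simp add: isCont_def)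
  then show "((\<lambda>x. 1 / (pi * x) * (\<integral>\<omega>. sin (x * G \<omega>) \<partial>M)) \<longlongrightarrow> u 0 t) (at 0)"
    by (rule Lim_transform_eventually)
      (use eq in \<open>auto simp: eventually_at_filter intro!: always_eventually\<close>)
qed

end
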